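(* Every $\Sigma$-formula $\phi$ is $\mathfrak{B}$-equivalent to an $\mathcal{L}_{BT}$-formula of the form $(\exists v_0)(Q_1v_1\sqsubseteq t_1)\cdots(Q_mv_m\sqsubseteq t_m)\,s=t$, where $s,t,t_1,\ldots,t_m$ are terms and $Q_j\in\{\exists,\forall\}$ for $j=1,\ldots,m$.
   Context: Bit strings are elements of $\{\mathbf{0},\mathbf{1}\}^*$; $\varepsilon$ is the empty string. The language $\mathcal{L}_{BT}$ has constant symbols $e,0,1$, binary function symbol $\circ$, and binary relation symbol $\sqsubseteq$. The structure $\mathfrak{B}$ has universe $\{\mathbf{0},\mathbf{1}\}^*$, interprets $e,0,1$ as $\varepsilon,\mathbf{0},\mathbf{1}$, $\circ$ as concatenation, and $\sqsubseteq$ as the substring relation ($\alpha\sqsubseteq\beta$ iff $\gamma\alpha\delta=\beta$ for some $\gamma,\delta$). $(\exists x\sqsubseteq t)\phi$ abbreviates $\exists x[x\sqsubseteq t\wedge\phi]$, $(\forall x\sqsubseteq t)\phi$ abbreviates $\forall x[x\sqsubseteq t\to\phi]$. $\Sigma$-formulas: $s\sqsubseteq t$, $\neg s\sqsubseteq t$, $s=t$, $\neg s=t$ (terms $s,t$) are $\Sigma$-formulas; they are closed under $\wedge,\vee$, and under $(\exists x\sqsubseteq t)$, $(\forall x\sqsubseteq t)$ and $\exists x$ where $x$ does not occur in $t$. Two formulas are $\mathfrak{B}$-equivalent if their biconditional (universally closed) holds in $\mathfrak{B}$. *)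

theory Defs
  imports Main "HOL-Library.Sublist"
begin

datatype bit = B0 | B1

type_synonym bitstring = "bit list"

type_synonym var = nat

datatype bt_term =
    Var var
  | Emp
  | Zero
  | One
  | Conc bt_term bt_term

fun term_vars :: "bt_term \<Rightarrow> var set" where
  "term_vars (Var x) = {x}"
| "term_vars Emp = {}"
| "term_vars Zero = {}"
| "term_vars One = {}"
| "term_vars (Conc s t) = term_vars s \<union> term_vars t"

datatype bt_form =
    Eq bt_term bt_term
  | Sub bt_term bt_term
  | Neg bt_form
  | And bt_form bt_form
  | Or bt_form bt_form
  | Imp bt_form bt_form
  | Ex var bt_form
  | All var bt_form

abbreviation Iff :: "bt_form \<Rightarrow> bt_form \<Rightarrow> bt_form" where
  "Iff \<phi> \<psi> \<equiv> And (Imp \<phi> \<psi>) (Imp \<psi> \<phi>)"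

abbreviation BEx :: "var \<Rightarrow> bt_term \<Rightarrow> bt_form \<Rightarrow> bt_form" where
  "BEx x t \<phi> \<equiv> Ex x (And (Sub (Var x) t) \<phi>)"

abbreviation BAll :: "var \<Rightarrow> bt_term \<Rightarrow> bt_form \<Rightarrow> bt_form" where
  "BAll x t \<phi> \<equiv> All x (Imp (Sub (Var x) t) \<phi>)"

fun eval :: "(var \<Rightarrow> bitstring) \<Rightarrow> bt_term \<Rightarrow> bitstring" where
  "eval \<rho> (Var x) = \<rho> x"
| "eval \<rho> Emp = []"
| "eval \<rho> Zero = [B0]"
| "eval \<rho> One = [B1]"
| "eval \<rho> (Conc s t) = eval \<rho> s @ eval \<rho> t"

text \<open>The library predicate \<^const>\<open>sublist\<close> is the contiguous substring relation
  (as opposed to \<^const>\<open>subseq\<close>).\<close>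

fun sat :: "(var \<Rightarrow> bitstring) \<Rightarrow> bt_form \<Rightarrow> bool" where
  "sat \<rho> (Eq s t) \<longleftrightarrow> eval \<rho> s = eval \<rho> t"
| "sat \<rho> (Sub s t) \<longleftrightarrow> sublist (eval \<rho> s) (eval \<rho> t)"
| "sat \<rho> (Neg \<phi>) \<longleftrightarrow> \<not> sat \<rho> \<phi>"
| "sat \<rho> (And \<phi> \<psi>) \<longleftrightarrow> sat \<rho> \<phi> \<and> sat \<rho> \<psi>"
| "sat \<rho> (Or \<phi> \<psi>) \<longleftrightarrow> sat \<rho> \<phi> \<or> sat \<rho> \<psi>"
| "sat \<rho> (Imp \<phi> \<psi>) \<longleftrightarrow> (sat \<rho> \<phi> \<longrightarrow> sat \<rho> \<psi>)"
| "sat \<rho> (Ex x \<phi>) \<longleftrightarrow> (\<exists>\<alpha>. sat (\<rho>(x := \<alpha>)) \<phi>)"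
| "sat \<rho> (All x \<phi>) \<longleftrightarrow> (\<forall>\<alpha>. sat (\<rho>(x := \<alpha>)) \<phi>)"

text \<open>Truth of the universal closure is truth under every assignment.\<close>

definition B_equiv :: "bt_form \<Rightarrow> bt_form \<Rightarrow> bool" where
  "B_equiv \<phi> \<psi> \<longleftrightarrow> (\<forall>\<rho>. sat \<rho> (Iff \<phi> \<psi>))"

inductive Sigma_form :: "bt_form \<Rightarrow> bool" where
  "Sigma_form (Sub s t)"
| "Sigma_form (Neg (Sub s t))"
| "Sigma_form (Eq s t)"
| "Sigma_form (Neg (Eq s t))"
| "Sigma_form \<phi> \<Longrightarrow> Sigma_form \<psi> \<Longrightarrow> Sigma_form (And \<phi> \<psi>)"
| "Sigma_form \<phi> \<Longrightarrow> Sigma_form \<psi> \<Longrightarrow> Sigma_form (Or \<phi> \<psi>)"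
| "Sigma_form \<phi> \<Longrightarrow> x \<notin> term_vars t \<Longrightarrow> Sigma_form (BEx x t \<phi>)"
| "Sigma_form \<phi> \<Longrightarrow> x \<notin> term_vars t \<Longrightarrow> Sigma_form (BAll x t \<phi>)"
| "Sigma_form \<phi> \<Longrightarrow> Sigma_form (Ex x \<phi>)"

datatype quant = Exists | Forall

fun bounded :: "quant \<times> var \<times> bt_term \<Rightarrow> bt_form \<Rightarrow> bt_form" where
  "bounded (Exists, x, t) \<phi> = BEx x t \<phi>"
| "bounded (Forall, x, t) \<phi> = BAll x t \<phi>"

text \<open>The head of the list is the outermost quantifier.\<close>

definition bounded_prefix :: "(quant \<times> var \<times> bt_term) list \<Rightarrow> bt_form \<Rightarrow> bt_form" where
  "bounded_prefix qs \<phi> = foldr bounded qs \<phi>"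

text \<open>The variables \<open>v\<^sub>0, \<dots>, v\<^sub>m\<close> are pairwise distinct, and no \<open>v\<^sub>j\<close> occurs in its own
  bound \<open>t\<^sub>j\<close>: otherwise \<open>v\<^sub>j \<sqsubseteq> v\<^sub>j\<close> would be an admissible bound and the quantifier
  would in effect be unbounded.\<close>

inductive normal_form :: "bt_form \<Rightarrow> bool" where
  "distinct (v0 # map (\<lambda>(q, v, b). v) qs) \<Longrightarrow>
   (\<And>q v b. (q, v, b) \<in> set qs \<Longrightarrow> v \<notin> term_vars b) \<Longrightarrow>
   normal_form (Ex v0 (bounded_prefix qs (Eq s t)))"

end

theory Submission imports Defs begin

text \<open>Bounded quantifiers range over nonempty finite sets, so they can be pulled out of
  conjunctions and disjunctions after renaming, and an unbounded existential quantifier moves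
  outwards past a bounded universal one by collecting the finitely many witnesses as substrings of
  a single string. It remains to merge equations. Conjunction:
  \<open>s = t \<and> u = v\<close> iff \<open>s0us1u = t0vt1v\<close>. Disjunction: pick \<open>P\<close>, \<open>Q\<close>, \<open>R\<close> of the same positive
  length with \<open>P = Q\<close> iff \<open>s = t\<close> and \<open>P = R\<close> iff \<open>u = v\<close>, and say that \<open>P = ab\<close> where \<open>a\<close> commutes
  with \<open>P\<close> and \<open>Q\<close>, and \<open>b\<close> commutes with \<open>P\<close> and \<open>R\<close>. One of \<open>a\<close>, \<open>b\<close> is nonempty, and two words
  of the same length that commute with a common nonempty word are equal.\<close>

section \<open>Combinatorics on words\<close>

text \<open>Each side consists of two halves of equal length, so the equation splits into s x u = t
  x v and s y u = t y v. If s were shorter than t, the letter of t at position |s| would be both x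
  and y; the other case is symmetric.\<close>

lemma marked_doubling_eq_iff:
  assumes "x \<noteq> y"
  shows "s @ x # u @ s @ y # u = t @ x # v @ t @ y # v \<longleftrightarrow> s = t \<and> u = v"
proof
  assume eq: "s @ x # u @ s @ y # u = t @ x # v @ t @ y # v"
  have "length (s @ x # u) = length (t @ x # v)"
    using arg_cong[OF eq, of length] by simp
  moreover have "(s @ x # u) @ (s @ y # u) = (t @ x # v) @ (t @ y # v)"
    using eq by simp
  ultimately have halves: "s @ x # u = t @ x # v" "s @ y # u = t @ y # v"
    by (metis append_eq_append_conv)+
  have "length s = length t"
  proof (rule ccontr)
    assume "length s \<noteq> length t"
    then consider "length s < length t" | "length t < length s" by linarith
    then show False
    proof cases
      case 1
      then have "t ! length s = x" "t ! length s = y"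
        using halves by (metis nth_append nth_append_length)+
      then show False using assms by simp
    next
      case 2
      then have "s ! length t = x" "s ! length t = y"
        using halves by (metis nth_append nth_append_length)+
      then show False using assms by simp
    qed
  qed
  then show "s = t \<and> u = v" using halves(1) by simp
qed simp

text \<open>The word \<open>w\<close> commutes with every power of \<open>x\<close>, and the n-th
  power of a nonempty \<open>x\<close> is at least as long as \<open>w\<close>. Commuting with this
  longer word makes \<open>w\<close> a prefix of it.\<close>

lemma commute_eq_take_power:
  assumes "x @ w = w @ x" "length w \<le> n" "x \<noteq> []"
  shows "w = take (length w) (concat (replicate n x))"
proof -
  have "concat (replicate n x) @ w = w @ concat (replicate n x)"
  proof (induction n)
    case (Suc n)
    then show ?case using assms(1) by simp
  qed simp
  moreover have "length w \<le> length (concat (replicate n x))"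
  proof -
    have "n \<le> n * length x"
      using assms(3) by (cases x) auto
    with assms(2) have "length w \<le> n * length x"
      by (rule le_trans)
    then show ?thesis by (simp add: length_concat sum_list_replicate)
  qed
  ultimately show ?thesis
    by (metis append_eq_append_conv_if append_eq_conv_conj)
qed

text \<open>Both words are prefixes of the same length of one power of \<open>x\<close>.\<close>

lemma commute_same_length_eq:
  assumes "x @ p = p @ x" "x @ q = q @ x" "x \<noteq> []" "length p = length q"
  shows "p = q"
  using commute_eq_take_power[OF assms(1) order_refl assms(3)]
    commute_eq_take_power[OF assms(2) order_refl assms(3)] assms(4) by simp

lemma eq_disj_iff_commuting_factors:
  assumes "p \<noteq> []" "length q = length p" "length r = length p"
  shows "p = q \<or> p = r \<longleftrightarrow>
    (\<exists>a b. a @ b = p \<and> a @ p = p @ a \<and> a @ q = q @ a \<and> b @ p = p @ b \<and> b @ r = r @ b)"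
proof
  assume "p = q \<or> p = r"
  \<comment> \<open>The witnesses are (p, []) if p = q and ([], p) if p = r.\<close>
  then show "\<exists>a b. a @ b = p \<and> a @ p = p @ a \<and> a @ q = q @ a \<and> b @ p = p @ b \<and> b @ r = r @ b"
    by (metis append_Nil append_Nil2)
next
  assume "\<exists>a b. a @ b = p \<and> a @ p = p @ a \<and> a @ q = q @ a \<and> b @ p = p @ b \<and> b @ r = r @ b"
  then show "p = q \<or> p = r"
    using assms commute_same_length_eq by (metis append_Nil)
qed

text \<open>Of two distinct words, either one properly extends the other or they part after a common
  prefix. The right side is negation-free, so inequality becomes expressible by equations. The
  variable \<open>x\<close> is the rest of a word in the first four disjuncts and the common prefix
  in the last two.\<close>

lemma list_neq_iff:
  fixes s t :: bitstring
  shows "s \<noteq> t \<longleftrightarrow> (\<exists>x y z. s = t @ B0 # x \<or> s = t @ B1 # x \<or> t = s @ B0 # x \<or> t = s @ B1 # x \<or>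
    s = x @ B0 # y \<and> t = x @ B1 # z \<or> s = x @ B1 # y \<and> t = x @ B0 # z)"
    (is "_ \<longleftrightarrow> ?R s t")
proof
  assume "s \<noteq> t"
  have bit: "b = B0 \<or> b = B1" for b by (cases b) auto
  consider "strict_prefix s t" | "strict_prefix t s" | "s \<parallel> t"
    using \<open>s \<noteq> t\<close> by (blast intro: strict_prefixI)
  then show "?R s t"
  proof cases
    case 1
    then obtain b x where "t = s @ b # x" by (rule strict_prefixE')
    then show ?thesis using bit[of b] by blast
  next
    case 2
    then obtain b x where "s = t @ b # x" by (rule strict_prefixE')
    then show ?thesis using bit[of b] by blast
  next
    case 3
    then obtain x b y c z where "b \<noteq> c" "s = x @ b # y" "t = x @ c # z"
      using parallel_decomp by blast
    then show ?thesis using bit[of b] bit[of c] by blast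
  qed
qed auto

text \<open>A word has finitely many substrings; the concatenation of one witness for each contains
  all of them, and monotonicity lets it replace each.\<close>

lemma finite_sublists_collect:
  assumes "\<forall>\<alpha>. sublist \<alpha> \<tau> \<longrightarrow> (\<exists>\<omega>. P \<alpha> \<omega>)"
    and mono: "\<And>\<alpha> \<omega> \<omega>'. P \<alpha> \<omega> \<Longrightarrow> sublist \<omega> \<omega>' \<Longrightarrow> P \<alpha> \<omega>'"
  shows "\<exists>\<omega>. \<forall>\<alpha>. sublist \<alpha> \<tau> \<longrightarrow> P \<alpha> \<omega>"
proof -
  have "\<exists>\<omega>. \<forall>\<alpha>\<in>A. P \<alpha> \<omega>" if "finite A" "\<forall>\<alpha>\<in>A. \<exists>\<omega>. P \<alpha> \<omega>" for A
    using that
  proof induction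
    case (insert a A)
    then obtain \<omega>1 \<omega>2 where "\<forall>\<alpha>\<in>A. P \<alpha> \<omega>1" "P a \<omega>2" by blast
    then have "\<forall>\<alpha>\<in>insert a A. P \<alpha> (\<omega>1 @ \<omega>2)"
      using mono by (metis insertE sublist_append_leftI sublist_append_rightI)
    then show ?case ..
  qed simp
  from this[of "{\<alpha>. sublist \<alpha> \<tau>}"] show ?thesis
    using assms(1) by (metis finite_set mem_Collect_eq set_sublists_eq)
qed

section \<open>Renaming and coincidence\<close>

lemma obtain_fresh:
  assumes "finite (V :: var set)"
  obtains x where "x \<notin> V"
  using assms by (metis ex_new_if_finite infinite_UNIV_nat)

lemma finite_term_vars [simp]: "finite (term_vars t)"
  by (induction t) auto

lemma eval_cong: "(\<And>x. x \<in> term_vars t \<Longrightarrow> \<rho> x = \<rho>' x) \<Longrightarrow> eval \<rho> t = eval \<rho>' t"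
  by (induction t) auto

lemma eval_upd [simp]: "x \<notin> term_vars t \<Longrightarrow> eval (\<rho>(x := \<alpha>)) t = eval \<rho> t"
  by (rule eval_cong) auto

fun rename :: "var \<Rightarrow> var \<Rightarrow> bt_term \<Rightarrow> bt_term" where
  "rename x y (Var z) = Var (if z = x then y else z)"
| "rename x y (Conc s t) = Conc (rename x y s) (rename x y t)"
| "rename x y t = t"

lemma eval_rename [simp]: "eval \<rho> (rename x y t) = eval (\<rho>(x := \<rho> y)) t"
  by (induction t) auto

lemma term_vars_rename: "term_vars (rename x y t) \<subseteq> insert y (term_vars t)"
  by (induction t) auto

fun free_vars :: "bt_form \<Rightarrow> var set" where
  "free_vars (Eq s t) = term_vars s \<union> term_vars t"
| "free_vars (Sub s t) = term_vars s \<union> term_vars t"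
| "free_vars (Neg \<phi>) = free_vars \<phi>"
| "free_vars (And \<phi> \<psi>) = free_vars \<phi> \<union> free_vars \<psi>"
| "free_vars (Or \<phi> \<psi>) = free_vars \<phi> \<union> free_vars \<psi>"
| "free_vars (Imp \<phi> \<psi>) = free_vars \<phi> \<union> free_vars \<psi>"
| "free_vars (Ex x \<phi>) = free_vars \<phi> - {x}"
| "free_vars (All x \<phi>) = free_vars \<phi> - {x}"

lemma finite_free_vars [simp]: "finite (free_vars \<phi>)"
  by (induction \<phi>) auto

lemma sat_cong: "(\<And>x. x \<in> free_vars \<phi> \<Longrightarrow> \<rho> x = \<rho>' x) \<Longrightarrow> sat \<rho> \<phi> \<longleftrightarrow> sat \<rho>' \<phi>"
proof (induction \<phi> arbitrary: \<rho> \<rho>')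
  case (Eq s t)
  then show ?case using eval_cong[of s \<rho> \<rho>'] eval_cong[of t \<rho> \<rho>'] by simp
next
  case (Sub s t)
  then show ?case using eval_cong[of s \<rho> \<rho>'] eval_cong[of t \<rho> \<rho>'] by simp
next
  case (Neg \<phi>)
  show ?case using Neg.IH[of \<rho> \<rho>'] Neg.prems by simp
next
  case (And \<phi> \<psi>)
  show ?case using And.IH[of \<rho> \<rho>'] And.prems by simp
next
  case (Or \<phi> \<psi>)
  show ?case using Or.IH[of \<rho> \<rho>'] Or.prems by simp
next
  case (Imp \<phi> \<psi>)
  show ?case using Imp.IH[of \<rho> \<rho>'] Imp.prems by simp
next
  case (Ex x \<phi>)
  have "sat (\<rho>(x := \<alpha>)) \<phi> \<longleftrightarrow> sat (\<rho>'(x := \<alpha>)) \<phi>" for \<alpha>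
    by (rule Ex.IH) (simp add: Ex.prems)
  then show ?case by simp
next
  case (All x \<phi>)
  have "sat (\<rho>(x := \<alpha>)) \<phi> \<longleftrightarrow> sat (\<rho>'(x := \<alpha>)) \<phi>" for \<alpha>
    by (rule All.IH) (simp add: All.prems)
  then show ?case by simp
qed

lemma sat_upd [simp]: "x \<notin> free_vars \<phi> \<Longrightarrow> sat (\<rho>(x := \<alpha>)) \<phi> \<longleftrightarrow> sat \<rho> \<phi>"
  by (rule sat_cong) auto

lemma B_equiv_iff: "B_equiv \<phi> \<psi> \<longleftrightarrow> (\<forall>\<rho>. sat \<rho> \<phi> \<longleftrightarrow> sat \<rho> \<psi>)"
  by (auto simp: B_equiv_def)

section \<open>Bounded prenex formulas\<close>

text \<open>These are the conditions that \<open>normal_form\<close> puts on the prefix, with a set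
  \<open>V\<close> of reserved variables; \<open>V = {v0}\<close> yields distinctness from the
  outermost variable.\<close>

definition admissible :: "var set \<Rightarrow> (quant \<times> var \<times> bt_term) list \<Rightarrow> bool" where
  "admissible V qs \<longleftrightarrow> distinct (map (\<lambda>(q, v, b). v) qs) \<and>
     (\<forall>q v b. (q, v, b) \<in> set qs \<longrightarrow> v \<notin> term_vars b \<and> v \<notin> V)"

lemma admissible_Cons [simp]:
  "admissible V ((q, v, b) # qs) \<longleftrightarrow> v \<notin> term_vars b \<and> v \<notin> V \<and> admissible (insert v V) qs"
  unfolding admissible_def by (auto simp: image_iff)

lemma admissible_Nil [simp]: "admissible V []"
  by (simp add: admissible_def)

lemma admissible_mono: "admissible V qs \<Longrightarrow> U \<subseteq> V \<Longrightarrow> admissible U qs"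
  unfolding admissible_def by blast

lemma bounded_prefix_simps [simp]:
  "bounded_prefix [] \<phi> = \<phi>"
  "bounded_prefix (q # qs) \<phi> = bounded q (bounded_prefix qs \<phi>)"
  by (simp_all add: bounded_prefix_def)

text \<open>The prefix can be chosen to bind no variable of a prescribed finite set.\<close>

definition bounded_prenex :: "bt_form \<Rightarrow> bool" where
  "bounded_prenex \<phi> \<longleftrightarrow> (\<forall>V. finite V \<longrightarrow>
     (\<exists>qs s t. admissible V qs \<and> B_equiv \<phi> (bounded_prefix qs (Eq s t))))"

lemma bounded_prenexE:
  assumes "bounded_prenex \<phi>" "finite V"
  obtains qs s t where "admissible V qs" "B_equiv \<phi> (bounded_prefix qs (Eq s t))"
  using assms unfolding bounded_prenex_def by blast

lemma bounded_prenex_cong: "bounded_prenex \<phi> \<Longrightarrow> B_equiv \<phi> \<psi> \<Longrightarrow> bounded_prenex \<psi>"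
  unfolding bounded_prenex_def B_equiv_iff by simp

lemma bounded_prenex_Eq: "bounded_prenex (Eq s t)"
  unfolding bounded_prenex_def B_equiv_iff by (metis admissible_Nil bounded_prefix_simps(1))

section \<open>Renaming inside a quantifier prefix\<close>

abbreviation rename_prefix where
  "rename_prefix x y \<equiv> map (\<lambda>(q, v, b). (q, v, rename x y b))"

text \<open>As \<open>y\<close> is reserved, no quantifier of the prefix binds it, so inserting
  \<open>y\<close> into a bound cannot put a bound variable into its own bound.\<close>

lemma admissible_rename_prefix:
  "admissible V qs \<Longrightarrow> y \<in> V \<Longrightarrow> admissible V (rename_prefix x y qs)"
proof (induction qs arbitrary: V)
  case (Cons a qs)
  obtain q v b where "a = (q, v, b)" by (cases a)
  then show ?case using Cons term_vars_rename[of x y b] by auto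
qed simp

text \<open>No quantifier of the prefix binds \<open>x\<close> or \<open>y\<close>, so nothing is
  captured: assigning a prefix variable commutes with giving \<open>x\<close> the value of
  \<open>y\<close>.\<close>

lemma sat_rename_prefix:
  assumes "admissible V qs" "x \<in> V" "y \<in> V"
  shows "sat \<rho> (bounded_prefix (rename_prefix x y qs) (Eq (rename x y s) (rename x y t))) \<longleftrightarrow>
    sat (\<rho>(x := \<rho> y)) (bounded_prefix qs (Eq s t))"
  using assms
proof (induction qs arbitrary: \<rho> V)
  case (Cons a qs)
  obtain q v b where a: "a = (q, v, b)" by (cases a)
  with Cons.prems have "v \<noteq> x" "v \<noteq> y" by auto
  then have upd: "(\<rho>(v := \<alpha>))(x := (\<rho>(v := \<alpha>)) y) = (\<rho>(x := \<rho> y))(v := \<alpha>)" for \<alpha>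
    by (auto simp: fun_upd_twist)
  have "sat (\<rho>(v := \<alpha>)) (bounded_prefix (rename_prefix x y qs) (Eq (rename x y s) (rename x y t)))
    \<longleftrightarrow> sat ((\<rho>(x := \<rho> y))(v := \<alpha>)) (bounded_prefix qs (Eq s t))" for \<alpha>
    using Cons.IH[of "insert v V" "\<rho>(v := \<alpha>)", unfolded upd] Cons.prems a
    by (simp del: fun_upd_apply)
  moreover have "eval (\<rho>(v := \<alpha>)) (rename x y b) = eval ((\<rho>(x := \<rho> y))(v := \<alpha>)) b" for \<alpha>
    unfolding eval_rename upd ..
  ultimately show ?case
    by (cases q) (simp_all add: a fun_upd_same del: eval_rename fun_upd_apply)
qed simp

text \<open>The bound variable may belong to the set to be avoided, so it is renamed.\<close>

lemma bounded_prenex_bounded: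
  assumes "bounded_prenex \<phi>" "x \<notin> term_vars b"
  shows "bounded_prenex (bounded (q, x, b) \<phi>)"
  unfolding bounded_prenex_def
proof (intro allI impI)
  fix V :: "var set"
  assume "finite V"
  then obtain y where y: "y \<notin> V \<union> term_vars b \<union> free_vars \<phi>"
    using obtain_fresh[of "V \<union> term_vars b \<union> free_vars \<phi>"] by auto
  \<comment> \<open>Reserving \<open>x\<close> and \<open>y\<close> as well makes the renaming of
    \<open>x\<close> to \<open>y\<close> capture-free.\<close>
  obtain qs s t where qs: "admissible (V \<union> {x, y}) qs"
    and eq: "B_equiv \<phi> (bounded_prefix qs (Eq s t))"
    using bounded_prenexE[OF assms(1), of "V \<union> {x, y}"] \<open>finite V\<close> by auto
  let ?qs = "rename_prefix x y qs" and ?E = "Eq (rename x y s) (rename x y t)"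
  have "admissible (V \<union> {x, y}) ?qs"
    using qs by (rule admissible_rename_prefix) simp
  then have "admissible (insert y V) ?qs"
    by (rule admissible_mono) auto
  then have "admissible V ((q, y, b) # ?qs)"
    using y by simp
  moreover have "sat (\<rho>(y := \<alpha>)) (bounded_prefix ?qs ?E) \<longleftrightarrow> sat (\<rho>(x := \<alpha>)) \<phi>" for \<rho> \<alpha>
  proof -
    have "sat (\<rho>(y := \<alpha>)) (bounded_prefix ?qs ?E) \<longleftrightarrow> sat (\<rho>(y := \<alpha>, x := \<alpha>)) \<phi>"
      using sat_rename_prefix[OF qs, of x y "\<rho>(y := \<alpha>)"] eq by (simp add: B_equiv_iff)
    \<comment> \<open>The value of \<open>y\<close> is irrelevant since \<open>y\<close> is not free
      in \<phi>.\<close>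
    also have "\<dots> \<longleftrightarrow> sat (\<rho>(x := \<alpha>)) \<phi>"
      using y by (intro sat_cong) auto
    finally show ?thesis .
  qed
  then have "B_equiv (bounded (q, x, b) \<phi>) (bounded_prefix ((q, y, b) # ?qs) ?E)"
    using y assms(2) by (cases q) (simp_all add: B_equiv_iff)
  ultimately show "\<exists>qs s t. admissible V qs \<and>
      B_equiv (bounded (q, x, b) \<phi>) (bounded_prefix qs (Eq s t))"
    by blast
qed

lemmas bounded_prenex_BEx = bounded_prenex_bounded[where q = Exists, unfolded bounded.simps]
  and bounded_prenex_BAll = bounded_prenex_bounded[where q = Forall, unfolded bounded.simps]

section \<open>Closure of bounded prenex formulas under conjunction and disjunction\<close>

lemma bounded_prenex_pull:
  assumes "c = And \<or> c = Or" "admissible (free_vars \<psi>) qs" "bounded_prenex (c \<phi> \<psi>)"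
  shows "bounded_prenex (c (bounded_prefix qs \<phi>) \<psi>)"
  using assms(2)
proof (induction qs)
  case (Cons a qs)
  obtain q v b where a: "a = (q, v, b)" by (cases a)
  with Cons.prems have v: "v \<notin> term_vars b" "v \<notin> free_vars \<psi>"
    and "admissible (free_vars \<psi>) qs"
    by (auto intro: admissible_mono)
  then have "bounded_prenex (bounded (q, v, b) (c (bounded_prefix qs \<phi>) \<psi>))"
    using Cons.IH bounded_prenex_bounded by blast
  \<comment> \<open>Nonemptiness of the range matters for pulling an existential quantifier out of a
    disjunction and a universal one out of a conjunction.\<close>
  moreover have "\<exists>\<alpha>. sublist \<alpha> (eval \<rho> b)" for \<rho>
    by blast
  then have "B_equiv (bounded (q, v, b) (c (bounded_prefix qs \<phi>) \<psi>))
      (c (bounded_prefix (a # qs) \<phi>) \<psi>)"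
    using assms(1) v by (cases q) (auto simp: a B_equiv_iff)
  ultimately show ?case by (rule bounded_prenex_cong)
qed (simp add: assms(3))

text \<open>The prefix of \<psi> is pulled out while the other side is a bare equation, then the
  prefix of \<phi> while the other side is \<psi>. The two prefixes may share variables, because
  bounded quantification over a bounded prenex formula renames.\<close>

lemma bounded_prenex_connective:
  assumes c: "c = And \<or> c = Or"
    and Eq: "\<And>s t u v. bounded_prenex (c (Eq s t) (Eq u v))"
    and "bounded_prenex \<phi>" "bounded_prenex \<psi>"
  shows "bounded_prenex (c \<phi> \<psi>)"
proof -
  have comm: "B_equiv (c \<phi>1 \<phi>2) (c \<phi>2 \<phi>1)" for \<phi>1 \<phi>2
    using c by (auto simp: B_equiv_iff)
  obtain qs s t where qs: "admissible (free_vars \<psi>) qs"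
    and \<phi>: "B_equiv \<phi> (bounded_prefix qs (Eq s t))"
    using bounded_prenexE[OF assms(3) finite_free_vars] .
  obtain qs' u v where qs': "admissible (free_vars (Eq s t)) qs'"
    and \<psi>: "B_equiv \<psi> (bounded_prefix qs' (Eq u v))"
    using bounded_prenexE[OF assms(4) finite_free_vars] .
  have "bounded_prenex (c (bounded_prefix qs' (Eq u v)) (Eq s t))"
    using c qs' Eq by (rule bounded_prenex_pull)
  moreover have "B_equiv (c (bounded_prefix qs' (Eq u v)) (Eq s t)) (c (Eq s t) \<psi>)"
    using c \<psi> by (auto simp: B_equiv_iff)
  ultimately have "bounded_prenex (c (Eq s t) \<psi>)"
    by (rule bounded_prenex_cong)
  with c qs have "bounded_prenex (c (bounded_prefix qs (Eq s t)) \<psi>)"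
    by (rule bounded_prenex_pull)
  moreover have "B_equiv (c (bounded_prefix qs (Eq s t)) \<psi>) (c \<phi> \<psi>)"
    using c \<phi> by (auto simp: B_equiv_iff)
  ultimately show ?thesis by (rule bounded_prenex_cong)
qed

abbreviation marked_doubling :: "bt_term \<Rightarrow> bt_term \<Rightarrow> bt_term" where
  "marked_doubling s u \<equiv> Conc s (Conc Zero (Conc u (Conc s (Conc One u))))"

lemma bounded_prenex_And:
  assumes "bounded_prenex \<phi>" "bounded_prenex \<psi>"
  shows "bounded_prenex (And \<phi> \<psi>)"
proof (rule bounded_prenex_connective[where c = And, OF _ _ assms])
  fix s t u v
  have "B_equiv (Eq (marked_doubling s u) (marked_doubling t v)) (And (Eq s t) (Eq u v))"
    by (simp add: B_equiv_iff marked_doubling_eq_iff)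
  then show "bounded_prenex (And (Eq s t) (Eq u v))"
    using bounded_prenex_Eq bounded_prenex_cong by blast
qed simp

lemma bounded_prenex_Or:
  assumes "bounded_prenex \<phi>" "bounded_prenex \<psi>"
  shows "bounded_prenex (Or \<phi> \<psi>)"
proof (rule bounded_prenex_connective[where c = Or, OF _ _ assms])
  fix s t u v
  \<comment> \<open>Swapping s and t gives \<open>Q\<close>, swapping u and v gives
    \<open>R\<close>. Swaps keep the length, and the marks make all three words nonempty.\<close>
  define P where "P = Conc (marked_doubling s t) (marked_doubling u v)"
  define Q where "Q = Conc (marked_doubling t s) (marked_doubling u v)"
  define R where "R = Conc (marked_doubling s t) (marked_doubling v u)"
  let ?V = "term_vars s \<union> term_vars t \<union> term_vars u \<union> term_vars v"
  obtain a where a: "a \<notin> ?V"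
    using obtain_fresh[of ?V] by auto
  obtain b where b: "b \<notin> insert a ?V"
    using obtain_fresh[of "insert a ?V"] by auto
  have fresh: "a \<notin> term_vars P" "b \<notin> term_vars P" "a \<notin> term_vars Q" "b \<notin> term_vars Q"
    "a \<notin> term_vars R" "b \<notin> term_vars R" "b \<noteq> a"
    using a b by (auto simp: P_def Q_def R_def)
  let ?commute = "\<lambda>x t. Eq (Conc (Var x) t) (Conc t (Var x))"
  \<comment> \<open>The bound \<open>P\<close> loses no witnesses: ab = P already makes a and b
    substrings of P.\<close>
  let ?\<chi> = "BEx a P (BEx b P (And (Eq (Conc (Var a) (Var b)) P)
    (And (And (?commute a P) (?commute a Q)) (And (?commute b P) (?commute b R)))))"
  have "bounded_prenex ?\<chi>"
    using fresh by (intro bounded_prenex_BEx bounded_prenex_And bounded_prenex_Eq)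
  moreover have "B_equiv ?\<chi> (Or (Eq s t) (Eq u v))"
    unfolding B_equiv_iff
  proof
    fix \<rho>
    let ?p = "eval \<rho> P" and ?q = "eval \<rho> Q" and ?r = "eval \<rho> R"
    have "?p = ?q \<longleftrightarrow> eval \<rho> s = eval \<rho> t"
      using marked_doubling_eq_iff[of B0 B1 "eval \<rho> s" "eval \<rho> t" "eval \<rho> t" "eval \<rho> s"]
      by (auto simp: P_def Q_def)
    moreover have "?p = ?r \<longleftrightarrow> eval \<rho> u = eval \<rho> v"
      using marked_doubling_eq_iff[of B0 B1 "eval \<rho> u" "eval \<rho> v" "eval \<rho> v" "eval \<rho> u"]
      by (auto simp: P_def R_def)
    moreover have "?p = ?q \<or> ?p = ?r \<longleftrightarrow> (\<exists>x y. x @ y = ?p \<and> x @ ?p = ?p @ x \<and> x @ ?q = ?q @ x \<and>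
        y @ ?p = ?p @ y \<and> y @ ?r = ?r @ y)"
      by (rule eq_disj_iff_commuting_factors) (simp_all add: P_def Q_def R_def)
    moreover have "sat \<rho> ?\<chi> \<longleftrightarrow> (\<exists>x y. x @ y = ?p \<and> x @ ?p = ?p @ x \<and> x @ ?q = ?q @ x \<and>
        y @ ?p = ?p @ y \<and> y @ ?r = ?r @ y)"
      using fresh by simp (metis sublist_append_leftI sublist_append_rightI)
    ultimately show "sat \<rho> ?\<chi> \<longleftrightarrow> sat \<rho> (Or (Eq s t) (Eq u v))"
      by simp
  qed
  ultimately show "bounded_prenex (Or (Eq s t) (Eq u v))"
    by (rule bounded_prenex_cong)
qed simp

section \<open>One unbounded existential quantifier\<close>

text \<open>Monotonicity of the matrix in \<open>w\<close> allows several existential quantifiers to share \<open>w\<close>, and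
  allows \<open>w\<close> to move outwards past a bounded universal quantifier.\<close>

definition ex_matrix :: "var \<Rightarrow> bt_form \<Rightarrow> bt_form \<Rightarrow> bool" where
  "ex_matrix w \<phi> \<chi> \<longleftrightarrow> bounded_prenex \<chi> \<and> (\<forall>\<rho>. sat \<rho> \<phi> \<longleftrightarrow> (\<exists>\<omega>. sat (\<rho>(w := \<omega>)) \<chi>)) \<and>
     (\<forall>\<rho> \<alpha> \<beta>. sat (\<rho>(w := \<alpha>)) \<chi> \<longrightarrow> sublist \<alpha> \<beta> \<longrightarrow> sat (\<rho>(w := \<beta>)) \<chi>)"

lemma ex_matrixE:
  assumes "ex_matrix w \<phi> \<chi>"
  obtains "bounded_prenex \<chi>" "\<And>\<rho>. sat \<rho> \<phi> \<longleftrightarrow> (\<exists>\<omega>. sat (\<rho>(w := \<omega>)) \<chi>)"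
    "\<And>\<rho> \<alpha> \<beta>. sat (\<rho>(w := \<alpha>)) \<chi> \<Longrightarrow> sublist \<alpha> \<beta> \<Longrightarrow> sat (\<rho>(w := \<beta>)) \<chi>"
  using assms unfolding ex_matrix_def by blast

text \<open>Allowing all but finitely many \<open>w\<close> lets both sides of a connective use the
  same \<open>w\<close>, and lets \<open>w\<close> differ from any given variable.\<close>

definition ex_prenex :: "bt_form \<Rightarrow> bool" where
  "ex_prenex \<phi> \<longleftrightarrow> (\<exists>F. finite F \<and> (\<forall>w. w \<notin> F \<longrightarrow> (\<exists>\<chi>. ex_matrix w \<phi> \<chi>)))"

lemma ex_prenexI:
  assumes "finite F" "\<And>w. w \<notin> F \<Longrightarrow> \<exists>\<chi>. ex_matrix w \<phi> \<chi>"
  shows "ex_prenex \<phi>"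
  using assms unfolding ex_prenex_def by blast

lemma ex_prenexE:
  assumes "ex_prenex \<phi>"
  obtains F where "finite F" "\<And>w. w \<notin> F \<Longrightarrow> \<exists>\<chi>. ex_matrix w \<phi> \<chi>"
  using assms unfolding ex_prenex_def by blast

lemma ex_prenex_cong: "ex_prenex \<phi> \<Longrightarrow> B_equiv \<phi> \<psi> \<Longrightarrow> ex_prenex \<psi>"
  unfolding ex_prenex_def ex_matrix_def B_equiv_iff by simp

section \<open>Closure under connectives and quantifiers\<close>

lemma ex_prenex_Eq: "ex_prenex (Eq s t)"
proof (rule ex_prenexI)
  fix w
  assume "w \<notin> term_vars s \<union> term_vars t"
  then show "\<exists>\<chi>. ex_matrix w (Eq s t) \<chi>"
    unfolding ex_matrix_def
    by (intro exI[of _ "Eq s t"]) (simp add: bounded_prenex_Eq)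
qed simp

lemma ex_prenex_connective:
  assumes c: "c = And \<or> c = Or" and "ex_prenex \<phi>" "ex_prenex \<psi>"
  shows "ex_prenex (c \<phi> \<psi>)"
proof -
  obtain F where F: "finite F"
    and \<phi>: "\<And>w. w \<notin> F \<Longrightarrow> \<exists>\<chi>. ex_matrix w \<phi> \<chi>"
    using ex_prenexE[OF assms(2)] by blast
  obtain G where G: "finite G"
    and \<psi>: "\<And>w. w \<notin> G \<Longrightarrow> \<exists>\<chi>. ex_matrix w \<psi> \<chi>"
    using ex_prenexE[OF assms(3)] by blast
  show ?thesis
  proof (rule ex_prenexI)
    fix w
    assume w: "w \<notin> F \<union> G"
    obtain \<chi> where "ex_matrix w \<phi> \<chi>"
      using \<phi>[of w] w by auto
    then have \<chi>: "bounded_prenex \<chi>" "\<And>\<rho>. sat \<rho> \<phi> \<longleftrightarrow> (\<exists>\<omega>. sat (\<rho>(w := \<omega>)) \<chi>)"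
      "\<And>\<rho> \<alpha> \<beta>. sat (\<rho>(w := \<alpha>)) \<chi> \<Longrightarrow> sublist \<alpha> \<beta> \<Longrightarrow> sat (\<rho>(w := \<beta>)) \<chi>"
      by (blast elim: ex_matrixE)+
    obtain \<xi> where "ex_matrix w \<psi> \<xi>"
      using \<psi>[of w] w by auto
    then have \<xi>: "bounded_prenex \<xi>" "\<And>\<rho>. sat \<rho> \<psi> \<longleftrightarrow> (\<exists>\<omega>. sat (\<rho>(w := \<omega>)) \<xi>)"
      "\<And>\<rho> \<alpha> \<beta>. sat (\<rho>(w := \<alpha>)) \<xi> \<Longrightarrow> sublist \<alpha> \<beta> \<Longrightarrow> sat (\<rho>(w := \<beta>)) \<xi>"
      by (blast elim: ex_matrixE)+
    \<comment> \<open>For a conjunction, the two witnesses are merged into their concatenation,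
      which serves both matrices by monotonicity.\<close>
    have "(\<exists>\<omega>. sat (\<rho>(w := \<omega>)) \<chi> \<and> sat (\<rho>(w := \<omega>)) \<xi>)"
      if "sat (\<rho>(w := \<alpha>)) \<chi>" "sat (\<rho>(w := \<beta>)) \<xi>" for \<rho> \<alpha> \<beta>
      using that \<chi>(3)[of \<rho> \<alpha> "\<alpha> @ \<beta>"] \<xi>(3)[of \<rho> \<beta> "\<alpha> @ \<beta>"] by auto
    then have "\<forall>\<rho>. sat \<rho> (c \<phi> \<psi>) \<longleftrightarrow> (\<exists>\<omega>. sat (\<rho>(w := \<omega>)) (c \<chi> \<xi>))"
      using c by (auto simp: \<chi>(2) \<xi>(2))
    moreover have "bounded_prenex (c \<chi> \<xi>)"
      using c \<chi>(1) \<xi>(1) by (auto intro: bounded_prenex_And bounded_prenex_Or)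
    moreover have "\<forall>\<rho> \<alpha> \<beta>. sat (\<rho>(w := \<alpha>)) (c \<chi> \<xi>) \<longrightarrow> sublist \<alpha> \<beta> \<longrightarrow> sat (\<rho>(w := \<beta>)) (c \<chi> \<xi>)"
      using c \<chi>(3) \<xi>(3) by auto
    ultimately show "\<exists>\<chi>. ex_matrix w (c \<phi> \<psi>) \<chi>"
      unfolding ex_matrix_def by blast
  qed (use F G in simp)
qed

lemmas ex_prenex_And = ex_prenex_connective[where c = And, simplified]
  and ex_prenex_Or = ex_prenex_connective[where c = Or, simplified]

text \<open>The variable \<open>w\<close> takes on the extra task of bounding \<open>x\<close>. A
  value \<alpha> of \<open>x\<close> and a witness \<omega> for the old matrix combine to the new
  witness \<alpha>\<omega>, which contains \<alpha> and still satisfies the old matrix.\<close>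

lemma ex_prenex_Ex:
  assumes "ex_prenex \<phi>"
  shows "ex_prenex (Ex x \<phi>)"
proof -
  obtain F where F: "finite F"
    and \<phi>: "\<And>w. w \<notin> F \<Longrightarrow> \<exists>\<chi>. ex_matrix w \<phi> \<chi>"
    using ex_prenexE[OF assms] by blast
  show ?thesis
  proof (rule ex_prenexI)
    fix w
    assume w: "w \<notin> insert x F"
    obtain \<chi> where "ex_matrix w \<phi> \<chi>"
      using \<phi>[of w] w by auto
    then have \<chi>: "bounded_prenex \<chi>" "\<And>\<rho>. sat \<rho> \<phi> \<longleftrightarrow> (\<exists>\<omega>. sat (\<rho>(w := \<omega>)) \<chi>)"
      "\<And>\<rho> \<alpha> \<beta>. sat (\<rho>(w := \<alpha>)) \<chi> \<Longrightarrow> sublist \<alpha> \<beta> \<Longrightarrow> sat (\<rho>(w := \<beta>)) \<chi>"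
      by (blast elim: ex_matrixE)+
    have twist: "\<rho>(w := \<omega>, x := \<alpha>) = \<rho>(x := \<alpha>, w := \<omega>)" for \<rho> :: "var \<Rightarrow> bitstring" and \<omega> \<alpha>
      using w by (simp add: fun_upd_twist)
    have sat_BEx: "sat (\<rho>(w := \<omega>)) (BEx x (Var w) \<chi>) \<longleftrightarrow>
        (\<exists>\<alpha>. sublist \<alpha> \<omega> \<and> sat (\<rho>(x := \<alpha>, w := \<omega>)) \<chi>)" for \<rho> \<omega>
      using w by (simp add: twist)
    have "bounded_prenex (BEx x (Var w) \<chi>)"
      using \<chi>(1) w by (intro bounded_prenex_BEx) auto
    moreover have "\<forall>\<rho>. sat \<rho> (Ex x \<phi>) \<longleftrightarrow> (\<exists>\<omega>. sat (\<rho>(w := \<omega>)) (BEx x (Var w) \<chi>))"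
    proof
      fix \<rho>
      have "\<exists>\<omega>. sublist \<alpha> \<omega> \<and> sat (\<rho>(x := \<alpha>, w := \<omega>)) \<chi>" if "sat (\<rho>(x := \<alpha>, w := \<omega>)) \<chi>" for \<alpha> \<omega>
        using \<chi>(3)[OF that, of "\<alpha> @ \<omega>"] by auto
      moreover have "sat \<rho> (Ex x \<phi>) \<longleftrightarrow> (\<exists>\<alpha> \<omega>. sat (\<rho>(x := \<alpha>, w := \<omega>)) \<chi>)"
        by (simp add: \<chi>(2))
      ultimately show "sat \<rho> (Ex x \<phi>) \<longleftrightarrow> (\<exists>\<omega>. sat (\<rho>(w := \<omega>)) (BEx x (Var w) \<chi>))"
        unfolding sat_BEx by blast
    qed
    moreover have "\<forall>\<rho> \<alpha> \<beta>. sat (\<rho>(w := \<alpha>)) (BEx x (Var w) \<chi>) \<longrightarrow> sublist \<alpha> \<beta> \<longrightarrow>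
        sat (\<rho>(w := \<beta>)) (BEx x (Var w) \<chi>)"
      unfolding sat_BEx using \<chi>(3) by (meson sublist_order.order_trans)
    ultimately show "\<exists>\<chi>. ex_matrix w (Ex x \<phi>) \<chi>"
      unfolding ex_matrix_def by blast
  qed (use F in simp)
qed

text \<open>The matrix is quantified in place. As \<open>w\<close> does not occur in
  \<open>t\<close>, the range of \<open>x\<close> does not depend on \<open>w\<close>, and
  \<open>finite_sublists_collect\<close> turns the witnesses for the single values of
  \<open>x\<close> into a common one.\<close>

lemma ex_prenex_BAll:
  assumes "ex_prenex \<phi>" "x \<notin> term_vars t"
  shows "ex_prenex (BAll x t \<phi>)"
proof -
  obtain F where F: "finite F"
    and \<phi>: "\<And>w. w \<notin> F \<Longrightarrow> \<exists>\<chi>. ex_matrix w \<phi> \<chi>"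
    using ex_prenexE[OF assms(1)] by blast
  show ?thesis
  proof (rule ex_prenexI)
    fix w
    assume w: "w \<notin> insert x (F \<union> term_vars t)"
    obtain \<chi> where "ex_matrix w \<phi> \<chi>"
      using \<phi>[of w] w by auto
    then have \<chi>: "bounded_prenex \<chi>" "\<And>\<rho>. sat \<rho> \<phi> \<longleftrightarrow> (\<exists>\<omega>. sat (\<rho>(w := \<omega>)) \<chi>)"
      "\<And>\<rho> \<alpha> \<beta>. sat (\<rho>(w := \<alpha>)) \<chi> \<Longrightarrow> sublist \<alpha> \<beta> \<Longrightarrow> sat (\<rho>(w := \<beta>)) \<chi>"
      by (blast elim: ex_matrixE)+
    have twist: "\<rho>(w := \<omega>, x := \<alpha>) = \<rho>(x := \<alpha>, w := \<omega>)" for \<rho> :: "var \<Rightarrow> bitstring" and \<omega> \<alpha>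
      using w by (simp add: fun_upd_twist)
    have sat_BAll: "sat (\<rho>(w := \<omega>)) (BAll x t \<chi>) \<longleftrightarrow>
        (\<forall>\<alpha>. sublist \<alpha> (eval \<rho> t) \<longrightarrow> sat (\<rho>(x := \<alpha>, w := \<omega>)) \<chi>)" for \<rho> \<omega>
      using w assms(2) by (simp add: twist)
    have "bounded_prenex (BAll x t \<chi>)"
      using \<chi>(1) assms(2) by (rule bounded_prenex_BAll)
    moreover have "\<forall>\<rho>. sat \<rho> (BAll x t \<phi>) \<longleftrightarrow> (\<exists>\<omega>. sat (\<rho>(w := \<omega>)) (BAll x t \<chi>))"
    proof
      fix \<rho>
      have "sat \<rho> (BAll x t \<phi>) \<longleftrightarrow>
          (\<forall>\<alpha>. sublist \<alpha> (eval \<rho> t) \<longrightarrow> (\<exists>\<omega>. sat (\<rho>(x := \<alpha>, w := \<omega>)) \<chi>))"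
        using assms(2) by (simp add: \<chi>(2))
      then show "sat \<rho> (BAll x t \<phi>) \<longleftrightarrow> (\<exists>\<omega>. sat (\<rho>(w := \<omega>)) (BAll x t \<chi>))"
        unfolding sat_BAll
        using finite_sublists_collect[of "eval \<rho> t" "\<lambda>\<alpha> \<omega>. sat (\<rho>(x := \<alpha>, w := \<omega>)) \<chi>"] \<chi>(3)
        by blast
    qed
    moreover have "\<forall>\<rho> \<alpha> \<beta>. sat (\<rho>(w := \<alpha>)) (BAll x t \<chi>) \<longrightarrow> sublist \<alpha> \<beta> \<longrightarrow>
        sat (\<rho>(w := \<beta>)) (BAll x t \<chi>)"
      unfolding sat_BAll using \<chi>(3) by blast
    ultimately show "\<exists>\<chi>. ex_matrix w (BAll x t \<phi>) \<chi>"
      unfolding ex_matrix_def by blast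
  qed (use F in simp)
qed

section \<open>Substring atoms and negated atoms\<close>

lemma ex_prenex_Sub: "ex_prenex (Sub s t)"
proof -
  let ?V = "term_vars s \<union> term_vars t"
  obtain x where x: "x \<notin> ?V"
    using obtain_fresh[of ?V] by auto
  obtain y where y: "y \<notin> insert x ?V"
    using obtain_fresh[of "insert x ?V"] by auto
  have "ex_prenex (Ex x (Ex y (Eq t (Conc (Var x) (Conc s (Var y))))))"
    by (intro ex_prenex_Ex ex_prenex_Eq)
  moreover have "B_equiv (Ex x (Ex y (Eq t (Conc (Var x) (Conc s (Var y)))))) (Sub s t)"
    using x y by (auto simp: B_equiv_iff sublist_def)
  ultimately show ?thesis by (rule ex_prenex_cong)
qed

lemma ex_prenex_Neg_Eq: "ex_prenex (Neg (Eq s t))"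
proof -
  let ?V = "term_vars s \<union> term_vars t"
  obtain x where x: "x \<notin> ?V"
    using obtain_fresh[of ?V] by auto
  obtain y where y: "y \<notin> insert x ?V"
    using obtain_fresh[of "insert x ?V"] by auto
  obtain z where z: "z \<notin> insert y (insert x ?V)"
    using obtain_fresh[of "insert y (insert x ?V)"] by auto
  let ?\<chi> = "Ex x (Ex y (Ex z
    (Or (Eq s (Conc t (Conc Zero (Var x)))) (Or (Eq s (Conc t (Conc One (Var x))))
    (Or (Eq t (Conc s (Conc Zero (Var x)))) (Or (Eq t (Conc s (Conc One (Var x))))
    (Or (And (Eq s (Conc (Var x) (Conc Zero (Var y)))) (Eq t (Conc (Var x) (Conc One (Var z)))))
        (And (Eq s (Conc (Var x) (Conc One (Var y)))) (Eq t (Conc (Var x) (Conc Zero (Var z))))))))))))"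
  have "ex_prenex ?\<chi>"
    by (intro ex_prenex_Ex ex_prenex_Or ex_prenex_And ex_prenex_Eq)
  moreover have "B_equiv ?\<chi> (Neg (Eq s t))"
    unfolding B_equiv_iff
  proof
    fix \<rho>
    show "sat \<rho> ?\<chi> \<longleftrightarrow> sat \<rho> (Neg (Eq s t))"
      using x y z list_neq_iff[of "eval \<rho> s" "eval \<rho> t"] by simp
  qed
  ultimately show ?thesis by (rule ex_prenex_cong)
qed

text \<open>Non-substring says that no x, y satisfy xsy = t. Such x and y would be substrings of t,
  so the universal quantifiers can be bounded by \<open>t\<close>, leaving a negated
  equation.\<close>

lemma ex_prenex_Neg_Sub: "ex_prenex (Neg (Sub s t))"
proof -
  let ?V = "term_vars s \<union> term_vars t"
  obtain x where x: "x \<notin> ?V"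
    using obtain_fresh[of ?V] by auto
  obtain y where y: "y \<notin> insert x ?V"
    using obtain_fresh[of "insert x ?V"] by auto
  let ?\<chi> = "BAll x t (BAll y t (Neg (Eq (Conc (Var x) (Conc s (Var y))) t)))"
  have "ex_prenex ?\<chi>"
    using x y by (intro ex_prenex_BAll ex_prenex_Neg_Eq) auto
  moreover have "B_equiv ?\<chi> (Neg (Sub s t))"
    unfolding B_equiv_iff
  proof
    fix \<rho>
    have "sublist \<alpha> (eval \<rho> t) \<and> sublist \<beta> (eval \<rho> t)" if "\<alpha> @ eval \<rho> s @ \<beta> = eval \<rho> t" for \<alpha> \<beta>
      using that by (metis append.assoc sublist_append_leftI sublist_append_rightI)
    then have "sublist (eval \<rho> s) (eval \<rho> t) \<longleftrightarrow> (\<exists>\<alpha> \<beta>. sublist \<alpha> (eval \<rho> t) \<and>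
        sublist \<beta> (eval \<rho> t) \<and> \<alpha> @ eval \<rho> s @ \<beta> = eval \<rho> t)"
      by (metis sublist_def)
    then show "sat \<rho> ?\<chi> \<longleftrightarrow> sat \<rho> (Neg (Sub s t))"
      using x y by auto
  qed
  ultimately show ?thesis by (rule ex_prenex_cong)
qed

text \<open>A bounded existential quantifier needs no lemma of its own, being \<open>Ex\<close> over
  a conjunction with a substring atom.\<close>

lemma Sigma_form_ex_prenex: "Sigma_form \<phi> \<Longrightarrow> ex_prenex \<phi>"
  by (induction rule: Sigma_form.induct)
    (auto intro: ex_prenex_Sub ex_prenex_Neg_Sub ex_prenex_Eq ex_prenex_Neg_Eq ex_prenex_And
      ex_prenex_Or ex_prenex_Ex ex_prenex_BAll)

theorem theorem10:
  fixes \<phi> :: bt_form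
  assumes "Sigma_form \<phi>"
  shows "\<exists>\<psi>. normal_form \<psi> \<and> B_equiv \<phi> \<psi>"
proof -
  obtain F where F: "finite F" "\<And>w. w \<notin> F \<Longrightarrow> \<exists>\<chi>. ex_matrix w \<phi> \<chi>"
    using ex_prenexE[OF Sigma_form_ex_prenex[OF assms]] by blast
  obtain w where "w \<notin> F"
    using obtain_fresh[OF F(1)] .
  then obtain \<chi> where "ex_matrix w \<phi> \<chi>"
    using F(2) by blast
  then have \<chi>: "bounded_prenex \<chi>" "B_equiv \<phi> (Ex w \<chi>)"
    by (auto simp: ex_matrix_def B_equiv_iff)
  \<comment> \<open>Reserving \<open>w\<close> keeps the prefix variables distinct from the
    outermost one.\<close>
  obtain qs s t where qs: "admissible {w} qs" and eq: "B_equiv \<chi> (bounded_prefix qs (Eq s t))"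
    using bounded_prenexE[OF \<chi>(1), of "{w}"] by auto
  have "normal_form (Ex w (bounded_prefix qs (Eq s t)))"
    using qs unfolding admissible_def by (intro normal_form.intros) auto
  moreover have "B_equiv \<phi> (Ex w (bounded_prefix qs (Eq s t)))"
    using \<chi>(2) eq by (simp add: B_equiv_iff)
  ultimately show ?thesis by blast
qed

end
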